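(* Let $n,u,t,\lambda,k,k_1,r,l$ be positive integers with $u,t\le n$, $\lambda>1$, $k_1=n-l-r$ and $k=l+k_1+1$, and put $u_0:=\lfloor 2u/2^{\lambda}\rfloor$. Suppose that there are a matrix $P\in\mathbb{F}_{2^\lambda}^{k_1\times r}$ and a matrix $H_0=[\,I_{l}\mid R\,]\in\mathbb{F}_2^{l\times n}$ (with $R\in\mathbb{F}_2^{l\times(n-l)}$) such that $H_0$ is a parity-check matrix of a binary linear code $\mathcal{C}_0$ of length $n$, dimension $k_1+r$ and minimum distance $d_0\ge u_0+1$, and such that, with $G_1:=[\,0_{k_1\times l}\mid I_{k_1}\mid P\,]\in\mathbb{F}_{2^\lambda}^{k_1\times n}$, the $(l+k_1+1)\times(n+1)$ matrix $$G=\begin{bmatrix} H_0 & 0_{l\times 1}\\ G_1 & 0_{k_1\times 1}\\ 1_{1\times n} & 1\end{bmatrix}$$ is a generator matrix of a linear code $\mathcal{C}$ over $\mathbb{F}_{2^\lambda}$ of length $n+1$, dimension $k=l+k_1+1$ and minimum distance $d\ge 2t+1$. Then the coding scheme given by the encoder and decoder described in the context is a $(u,t)$-PSMC (for partially stuck level $s=1$) of length $n+1$ and cardinality $$\mathcal{M}_{u,t}=2^{\lambda(k_1+l)-l}.$$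
   Context: Partially stuck cells. Let $q$ be a prime power and fix a total ordering of $\mathbb{F}_q$ in which $a\ge 1\ge 0$ for all $a\in\mathbb{F}_q\setminus\{0\}$. A cell is partially stuck at level $s$ if it can only store values that are at least $s$. Here all partially stuck cells are partially stuck at level $s=1$, i.e. they can store exactly the nonzero elements of $\mathbb{F}_q$. $(u,t)$-PSMC (partially-stuck-at-masking code) of length $N$ and cardinality $M$ over $\mathbb{F}_q$, for level $s=1$: a pair consisting of an encoder and a decoder. The encoder takes as input a set $\phi=\{\phi_0,\dots,\phi_{u-1}\}\subseteq\{0,\dots,N-1\}$ of $u$ positions of partially stuck cells and a message from a message space of cardinality $M$, and outputs a vector $c\in\mathbb{F}_q^{N}$ with $c_{\phi_i}\ge 1$ (i.e. $c_{\phi_i}\ne 0$) for all $i$. The decoder is a map (it does not receive $\phi$) that, for every encoder output $c$ and every $e\in\mathbb{F}_q^N$ of Hamming weight at most $t$, returns from $c+e$ the message that was encoded. Field notation. Here $q=2^\lambda$ and $N=n+1$. Let $x^0=1,x^1,\dots,x^{\lambda-1}$ be a basis of $\mathbb{F}_{2^\lambda}$ over $\mathbb{F}_2$, so every element is uniquely $\sum_{i=0}^{\lambda-1}a_ix^i$ with $a_i\in\mathbb{F}_2$. Let $\mathcal{F}:=\{\sum_{i=0}^{\lambda-1}a_ix^i: a_0=0\}$ and let $\varphi:\mathbb{F}_{2^\lambda}\to\mathcal{F}$, $\sum_{i=0}^{\lambda-1}a_ix^i\mapsto\sum_{i=1}^{\lambda-1}a_ix^i$. Coordinates of vectors of length $n+1$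 are indexed $0,\dots,n$; $\mathbf{1}$ is the all-one vector of length $n+1$; for a vector $w$, $(w)_\phi$ is its subvector indexed by $\phi$. Encoder. Input: a message $(m,m')$ with $m\in\mathbb{F}_{2^\lambda}^{k_1}$ and $m'\in\mathcal{F}^{l}$, and a set $\phi\subseteq\{0,\dots,n\}$ of $u$ positions. (1) $a:=m'\cdot[H_0\mid 0]$, $b:=m\cdot[G_1\mid 0]$. (2) Choose $\zeta\in\mathcal{F}$ such that $(a+b+(\zeta+1)\mathbf{1})_\phi$ has at most $u_0$ entries in $\mathbb{F}_2$, and put $w:=a+b+(\zeta+1)\mathbf{1}$. (3) Choose $z\in\mathbb{F}_2^{l}$ such that for each $i=0,\dots,u-1$ the entry of $[zH_0\mid 0]$ at position $\phi_i$ makes the following hold: it is $0$ if $w_{\phi_i}=1$, it is $1$ if $w_{\phi_i}=0$, and it is arbitrary if $w_{\phi_i}\notin\mathbb{F}_2$. (4) Output $w+[zH_0\mid 0]$. (That the scheme is a PSMC includes the assertion that the choices in (2) and (3) are always possible.) Decoder. Input: $y=c+e\in\mathbb{F}_{2^\lambda}^{n+1}$ with $c$ an encoder output and $e$ of Hamming weight at most $t$. (1) $v:=$ the result of decoding $y$ in $\mathcal{C}$ (the unique codeword of $\mathcal{C}$ within Hamming distance $t$ of $y$). (2) $v':=v-v_n\mathbf{1}$. (3) $\hat m'':=(v'_0,\dots,v'_{l-1})$ and $\hat m':=(\varphi(\hat m''_0),\dots,\varphi(\hat m''_{l-1}))$. (4) $v'':=v'-\hat m''\cdot[\,I_l\mid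 R\mid 0_{l\times1}\,]$ and $\hat m:=(v''_l,\dots,v''_{l+k_1-1})$. (5) Output $(\hat m,\hat m')$. *)

theory Defs
  imports "Jordan_Normal_Form.Matrix_Kernel" "HOL-Library.Z2"
begin

text \<open>Vectors and matrices are those of \<^theory>\<open>Jordan_Normal_Form.Matrix\<close>, indexed from 0.
  Vectors are columns there; the product of a row vector \<open>v\<close> with a matrix \<open>A\<close>
  is therefore \<open>transpose_mat A *\<^sub>v v\<close>.\<close>

definition append_cols :: "'a::zero mat \<Rightarrow> 'a mat \<Rightarrow> 'a mat"  (infixr \<open>@\<^sub>c\<close> 67) where
  "A @\<^sub>c B = four_block_mat A B (0\<^sub>m 0 (dim_col A)) (0\<^sub>m 0 (dim_col B))"

definition row_mult :: "'a::comm_semiring_0 vec \<Rightarrow> 'a mat \<Rightarrow> 'a vec"  (infixl \<open>\<^sub>v*\<close> 70) where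
  "v \<^sub>v* A = transpose_mat A *\<^sub>v v"

definition ones_vec :: "nat \<Rightarrow> 'a::one vec" where
  "ones_vec N = vec N (\<lambda>_. 1)"

definition hamming_weight :: "'a::zero vec \<Rightarrow> nat" where
  "hamming_weight v = card {i. i < dim_vec v \<and> v $ i \<noteq> 0}"

definition hamming_dist :: "'a vec \<Rightarrow> 'a vec \<Rightarrow> nat" where
  "hamming_dist v w = card {i. i < dim_vec v \<and> v $ i \<noteq> w $ i}"

definition linear_code :: "nat \<Rightarrow> nat \<Rightarrow> 'a::field vec set \<Rightarrow> bool" where
  "linear_code N k C \<longleftrightarrow>
     VectorSpace.subspace class_ring C (module_vec TYPE('a) N) \<and>
     vectorspace.dim class_ring ((module_vec TYPE('a) N)\<lparr>carrier := C\<rparr>) = k"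

text \<open>Only meaningful for codes with at least two words (\<open>Inf {} = 0\<close> on \<^typ>\<open>nat\<close>).\<close>

definition min_dist :: "'a vec set \<Rightarrow> nat" where
  "min_dist C = Inf {hamming_dist v w | v w. v \<in> C \<and> w \<in> C \<and> v \<noteq> w}"

definition generator_matrix :: "'a::field mat \<Rightarrow> 'a vec set \<Rightarrow> bool" where
  "generator_matrix G C \<longleftrightarrow>
     distinct (rows G) \<and>
     module.lin_indpt class_ring (module_vec TYPE('a) (dim_col G)) (set (rows G)) \<and>
     vec_space.row_space (dim_col G) G = C"

definition parity_check_matrix :: "'a::field mat \<Rightarrow> 'a vec set \<Rightarrow> bool" where
  "parity_check_matrix H C \<longleftrightarrow> mat_kernel H = C"

text \<open>A total order of the field, as a relation (\<open>(a, b) \<in> leq\<close> means \<open>a \<le> b\<close>), with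
  \<open>a \<ge> 1 \<ge> 0\<close> for all nonzero \<open>a\<close>.\<close>

definition level_order :: "'a::field rel \<Rightarrow> bool" where
  "level_order leq \<longleftrightarrow> linear_order leq \<and> (0, 1) \<in> leq \<and> (\<forall>a. a \<noteq> 0 \<longrightarrow> (1, a) \<in> leq)"

text \<open>\<open>N\<close> is the length, \<open>M\<close> the cardinality, \<open>s\<close> the level; the decoder is not given the set
  \<open>\<phi>\<close> of partially stuck positions.\<close>

definition psmc ::
  "'a::{finite,field} rel \<Rightarrow> 'a \<Rightarrow> nat \<Rightarrow> nat \<Rightarrow> nat \<Rightarrow> nat \<Rightarrow> 'm set \<Rightarrow>
   (nat set \<Rightarrow> 'm \<Rightarrow> 'a vec) \<Rightarrow> ('a vec \<Rightarrow> 'm) \<Rightarrow> bool" where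
  "psmc leq s u t N M Msg enc dec \<longleftrightarrow>
     finite Msg \<and> card Msg = M \<and>
     (\<forall>\<phi> \<mu>. \<phi> \<subseteq> {0..<N} \<and> card \<phi> = u \<and> \<mu> \<in> Msg \<longrightarrow>
        enc \<phi> \<mu> \<in> carrier_vec N \<and>
        (\<forall>i\<in>\<phi>. (s, enc \<phi> \<mu> $ i) \<in> leq) \<and>
        (\<forall>e\<in>carrier_vec N. hamming_weight e \<le> t \<longrightarrow> dec (enc \<phi> \<mu> + e) = \<mu>))"

text \<open>\<open>of_bit :: bit \<Rightarrow> 'a\<close> is the embedding of \<open>F\<^sub>2\<close>; it is a field homomorphism only in
  characteristic 2. Below, \<open>zero_const_elems\<close> is the set of elements whose coordinate at
  \<open>x\<^sup>0\<close> vanishes and \<open>drop_const\<close> the projection onto it.\<close>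

definition binary_comb :: "nat \<Rightarrow> 'a::field \<Rightarrow> bit vec \<Rightarrow> 'a" where
  "binary_comb lam x a = (\<Sum>i<lam. of_bit (a $ i) * x ^ i)"

definition binary_power_basis :: "nat \<Rightarrow> 'a::field \<Rightarrow> bool" where
  "binary_power_basis lam x \<longleftrightarrow> (\<forall>y. \<exists>!a. a \<in> carrier_vec lam \<and> y = binary_comb lam x a)"

definition binary_coords :: "nat \<Rightarrow> 'a::field \<Rightarrow> 'a \<Rightarrow> bit vec" where
  "binary_coords lam x y = (THE a. a \<in> carrier_vec lam \<and> y = binary_comb lam x a)"

definition zero_const_elems :: "nat \<Rightarrow> 'a::field \<Rightarrow> 'a set" where
  "zero_const_elems lam x = {binary_comb lam x a | a. a \<in> carrier_vec lam \<and> a $ 0 = 0}"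

definition drop_const :: "nat \<Rightarrow> 'a::field \<Rightarrow> 'a \<Rightarrow> 'a" where
  "drop_const lam x y = (\<Sum>i = 1..<lam. of_bit (binary_coords lam x y $ i) * x ^ i)"

definition lift_mat :: "bit mat \<Rightarrow> 'a::field mat" where
  "lift_mat A = map_mat of_bit A"

definition lift_vec :: "bit vec \<Rightarrow> 'a::field vec" where
  "lift_vec v = map_vec of_bit v"

text \<open>In block notation: \<open>H0_mat l R = [I | R]\<close>, \<open>G1_mat l k\<^sub>1 P = [0 | I | P]\<close>; the
  \<open>_ext\<close> versions append a zero column and live over the big field.\<close>

definition H0_mat :: "nat \<Rightarrow> bit mat \<Rightarrow> bit mat" where
  "H0_mat l R = 1\<^sub>m l @\<^sub>c R"

definition G1_mat :: "nat \<Rightarrow> nat \<Rightarrow> 'a::field mat \<Rightarrow> 'a mat" where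
  "G1_mat l k\<^sub>1 P = 0\<^sub>m k\<^sub>1 l @\<^sub>c 1\<^sub>m k\<^sub>1 @\<^sub>c P"

definition H0_ext :: "nat \<Rightarrow> bit mat \<Rightarrow> 'a::field mat" where
  "H0_ext l R = lift_mat (H0_mat l R) @\<^sub>c 0\<^sub>m l 1"

definition G1_ext :: "nat \<Rightarrow> nat \<Rightarrow> 'a::field mat \<Rightarrow> 'a mat" where
  "G1_ext l k\<^sub>1 P = G1_mat l k\<^sub>1 P @\<^sub>c 0\<^sub>m k\<^sub>1 1"

definition G_mat :: "nat \<Rightarrow> nat \<Rightarrow> nat \<Rightarrow> 'a::field mat \<Rightarrow> bit mat \<Rightarrow> 'a mat" where
  "G_mat n l k\<^sub>1 P R =
     H0_ext l R @\<^sub>r G1_ext l k\<^sub>1 P @\<^sub>r mat 1 (n + 1) (\<lambda>_. 1)"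

definition messages :: "nat \<Rightarrow> 'a::field \<Rightarrow> nat \<Rightarrow> nat \<Rightarrow> ('a vec \<times> 'a vec) set" where
  "messages lam x k\<^sub>1 l =
     carrier_vec k\<^sub>1 \<times> {m' \<in> carrier_vec l. \<forall>i<l. m' $ i \<in> zero_const_elems lam x}"

definition base_word ::
  "nat \<Rightarrow> nat \<Rightarrow> nat \<Rightarrow> 'a::field mat \<Rightarrow> bit mat \<Rightarrow> 'a vec \<times> 'a vec \<Rightarrow> 'a \<Rightarrow> 'a vec" where
  "base_word n l k\<^sub>1 P R = (\<lambda>(m, m') \<zeta>.
     m' \<^sub>v* H0_ext l R + m \<^sub>v* G1_ext l k\<^sub>1 P + (\<zeta> + 1) \<cdot>\<^sub>v ones_vec (n + 1))"

text \<open>The admissible choices of \<open>\<zeta>\<close> in encoding step 2 (the subfield \<open>F\<^sub>2\<close> is \<open>{0, 1}\<close>) and,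
  for the resulting word \<open>w\<close>, those of \<open>z\<close> in step 3.\<close>

definition zeta_choice ::
  "nat \<Rightarrow> nat \<Rightarrow> nat \<Rightarrow> nat \<Rightarrow> 'a::field \<Rightarrow> nat \<Rightarrow> 'a mat \<Rightarrow> bit mat \<Rightarrow>
   nat set \<Rightarrow> 'a vec \<times> 'a vec \<Rightarrow> 'a \<Rightarrow> bool" where
  "zeta_choice n l k\<^sub>1 lam x u\<^sub>0 P R \<phi> \<mu> \<zeta> \<longleftrightarrow>
     \<zeta> \<in> zero_const_elems lam x \<and>
     card {i \<in> \<phi>. base_word n l k\<^sub>1 P R \<mu> \<zeta> $ i \<in> {0, 1}} \<le> u\<^sub>0"

definition mask_choice ::
  "nat \<Rightarrow> bit mat \<Rightarrow> nat set \<Rightarrow> 'a::field vec \<Rightarrow> bit vec \<Rightarrow> bool" where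
  "mask_choice l R \<phi> w z \<longleftrightarrow>
     z \<in> carrier_vec l \<and>
     (\<forall>i\<in>\<phi>. (w $ i = 1 \<longrightarrow> (lift_vec z \<^sub>v* H0_ext l R :: 'a vec) $ i = 0) \<and>
            (w $ i = 0 \<longrightarrow> (lift_vec z \<^sub>v* H0_ext l R :: 'a vec) $ i = 1))"

definition encoder_output ::
  "nat \<Rightarrow> nat \<Rightarrow> nat \<Rightarrow> nat \<Rightarrow> 'a::field \<Rightarrow> nat \<Rightarrow> 'a mat \<Rightarrow> bit mat \<Rightarrow>
   nat set \<Rightarrow> 'a vec \<times> 'a vec \<Rightarrow> 'a vec \<Rightarrow> bool" where
  "encoder_output n l k\<^sub>1 lam x u\<^sub>0 P R \<phi> \<mu> c \<longleftrightarrow>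
     (\<exists>\<zeta> z. zeta_choice n l k\<^sub>1 lam x u\<^sub>0 P R \<phi> \<mu> \<zeta> \<and>
            mask_choice l R \<phi> (base_word n l k\<^sub>1 P R \<mu> \<zeta>) z \<and>
            c = base_word n l k\<^sub>1 P R \<mu> \<zeta> + lift_vec z \<^sub>v* H0_ext l R)"

text \<open>A value is only prescribed for words within distance \<open>t\<close> of exactly one codeword.\<close>

definition bounded_dist_decode :: "nat \<Rightarrow> 'a vec set \<Rightarrow> 'a vec \<Rightarrow> 'a vec" where
  "bounded_dist_decode t C y = (THE v. v \<in> C \<and> hamming_dist y v \<le> t)"

definition decoder ::
  "nat \<Rightarrow> nat \<Rightarrow> nat \<Rightarrow> nat \<Rightarrow> nat \<Rightarrow> 'a::field \<Rightarrow> 'a vec set \<Rightarrow> bit mat \<Rightarrow>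
   'a vec \<Rightarrow> 'a vec \<times> 'a vec" where
  "decoder n l k\<^sub>1 t lam x C R y =
     (let v = bounded_dist_decode t C y;
          v' = v - (v $ n) \<cdot>\<^sub>v ones_vec (n + 1);
          m'' = vec l (\<lambda>i. v' $ i);
          m' = map_vec (drop_const lam x) m'';
          v'' = v' - m'' \<^sub>v* H0_ext l R;
          m = vec k\<^sub>1 (\<lambda>i. v'' $ (l + i))
      in (m, m'))"

end

theory Submission
  imports Defs
begin

text \<open>Since \<open>1\<close> is a basis element, every element of the field lies in exactly one of
  \<open>zero_const_elems\<close> and its translate by \<open>1\<close>; hence each stuck position takes a value in
  \<open>{0, 1}\<close> for exactly one \<open>\<zeta>\<close>, and averaging over the \<open>2 ^ (lam - 1)\<close> choices of \<open>\<zeta>\<close>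
  leaves at most \<open>2 * u / 2 ^ lam\<close> such positions. Fewer than \<open>d\<^sub>0\<close> columns of \<open>H\<^sub>0\<close> are linearly
  independent, so a combination of the rows of \<open>H\<^sub>0\<close> can be prescribed at these positions.
  Position \<open>n\<close> lies outside \<open>H\<^sub>0\<close> but carries \<open>\<zeta> + 1 \<noteq> 0\<close>.
  The mask only adds a binary vector to \<open>m'\<close> in the coordinates of the generator matrix, so the output
  is a codeword and \<open>drop_const\<close> removes the mask again.\<close>

section \<open>Row vectors times block matrices\<close>

lemma append_cols_carrier [simp, intro]:
  "A \<in> carrier_mat nr nc1 \<Longrightarrow> B \<in> carrier_mat nr nc2 \<Longrightarrow> A @\<^sub>c B \<in> carrier_mat nr (nc1 + nc2)"
  by (auto simp: append_cols_def)

lemma row_mult_carrier [simp, intro]: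
  "A \<in> carrier_mat nr nc \<Longrightarrow> v \<^sub>v* A \<in> carrier_vec nc"
  by (intro carrier_vecI) (simp add: row_mult_def)

lemma index_row_mult:
  assumes "A \<in> carrier_mat nr nc" "j < nc"
  shows "(v \<^sub>v* A) $ j = col A j \<bullet> v"
  using assms by (auto simp: row_mult_def)

lemma row_mult_append_cols:
  assumes "A \<in> carrier_mat nr nc1" "B \<in> carrier_mat nr nc2" "v \<in> carrier_vec nr"
  shows "v \<^sub>v* (A @\<^sub>c B) = (v \<^sub>v* A) @\<^sub>v (v \<^sub>v* B)"
proof (rule eq_vecI)
  fix i assume "i < dim_vec ((v \<^sub>v* A) @\<^sub>v (v \<^sub>v* B))"
  then have i: "i < nc1 + nc2" using assms by (simp add: row_mult_def)
  have "col (A @\<^sub>c B) i = (if i < nc1 then col A i else col B (i - nc1))"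
    using assms i by (intro eq_vecI) (auto simp: append_cols_def)
  then show "(v \<^sub>v* (A @\<^sub>c B)) $ i = ((v \<^sub>v* A) @\<^sub>v (v \<^sub>v* B)) $ i"
    using assms i by (auto simp: row_mult_def append_cols_def)
qed (use assms in \<open>simp add: row_mult_def append_cols_def\<close>)

lemma row_mult_append_rows:
  fixes A B :: "'a::comm_semiring_0 mat"
  assumes "A \<in> carrier_mat nr1 nc" "B \<in> carrier_mat nr2 nc"
    and "v \<in> carrier_vec nr1" "w \<in> carrier_vec nr2"
  shows "(v @\<^sub>v w) \<^sub>v* (A @\<^sub>r B) = v \<^sub>v* A + w \<^sub>v* B"
proof (rule eq_vecI)
  fix i assume "i < dim_vec (v \<^sub>v* A + w \<^sub>v* B)"
  then have i: "i < nc" using assms by (simp add: row_mult_def)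
  have "col (A @\<^sub>r B) i = col A i @\<^sub>v col B i"
    using assms i by (intro eq_vecI) (auto simp: append_rows_def)
  moreover have "(col A i @\<^sub>v col B i) \<bullet> (v @\<^sub>v w) = col A i \<bullet> v + col B i \<bullet> w"
    using assms by (intro scalar_prod_append) auto
  ultimately show "((v @\<^sub>v w) \<^sub>v* (A @\<^sub>r B)) $ i = (v \<^sub>v* A + w \<^sub>v* B) $ i"
    using assms i by (auto simp: row_mult_def append_rows_def)
qed (use assms in \<open>simp add: row_mult_def append_rows_def\<close>)

lemma row_mult_one [simp]:
  "v \<in> carrier_vec n \<Longrightarrow> v \<^sub>v* 1\<^sub>m n = (v :: 'a::comm_semiring_1 vec)"
  by (simp add: row_mult_def)

lemma row_mult_zero [simp]:
  "v \<in> carrier_vec nr \<Longrightarrow> v \<^sub>v* 0\<^sub>m nr nc = 0\<^sub>v nc"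
  by (auto simp: row_mult_def intro!: eq_vecI)

lemma row_mult_add_left:
  assumes "A \<in> carrier_mat nr nc" "v \<in> carrier_vec nr" "w \<in> carrier_vec nr"
  shows "(v + w) \<^sub>v* A = v \<^sub>v* A + w \<^sub>v* A"
  using assms unfolding row_mult_def by (intro mult_add_distrib_mat_vec) auto

lemma row_mult_smult_left:
  fixes A :: "'a::field mat"
  assumes "A \<in> carrier_mat nr nc" "v \<in> carrier_vec nr"
  shows "(a \<cdot>\<^sub>v v) \<^sub>v* A = a \<cdot>\<^sub>v (v \<^sub>v* A)"
  using assms unfolding row_mult_def by (intro mult_mat_vec[where nc = nr and nr = nc]) auto

lemma row_mult_ones:
  fixes a :: "'a::comm_semiring_1"
  shows "vec 1 (\<lambda>_. a) \<^sub>v* mat 1 N (\<lambda>_. 1) = a \<cdot>\<^sub>v ones_vec N"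
  by (rule eq_vecI) (auto simp: row_mult_def ones_vec_def scalar_prod_def)

section \<open>Prescribing coordinates in a row space\<close>

text \<open>Duality: a functional that vanishes on the common kernel of finitely many functionals is
  a combination of them. In the induction the new \<open>f a\<close> either already vanishes on the
  common kernel of the others and gets coefficient 0, or some \<open>y\<close> in that kernel
  detects it, and a multiple of \<open>f a\<close> is split off \<open>g\<close>.\<close>

lemma mem_span_of_vanishing:
  fixes g :: "'a::field vec"
  assumes "finite T" "\<And>i. i \<in> T \<Longrightarrow> f i \<in> carrier_vec l" "g \<in> carrier_vec l"
    and "\<And>z. z \<in> carrier_vec l \<Longrightarrow> (\<And>i. i \<in> T \<Longrightarrow> f i \<bullet> z = 0) \<Longrightarrow> g \<bullet> z = 0"
  shows "\<exists>c. \<forall>j<l. g $ j = (\<Sum>i\<in>T. c i * f i $ j)"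
  using assms
proof (induction T arbitrary: g rule: finite_induct)
  case empty
  have "g $ j = 0" if "j < l" for j
    using empty(3)[of "unit_vec l j"] empty(2) that by simp
  then show ?case by auto
next
  case (insert a T)
  note fc = insert.prems(1) and gc = insert.prems(2) and van = insert.prems(3)
  have fa: "f a \<in> carrier_vec l" using fc by simp
  show ?case
  proof (cases "\<exists>y\<in>carrier_vec l. (\<forall>i\<in>T. f i \<bullet> y = 0) \<and> f a \<bullet> y \<noteq> 0")
    case False
    have "\<exists>c. \<forall>j<l. g $ j = (\<Sum>i\<in>T. c i * f i $ j)"
      using False fc gc by (intro insert.IH van) auto
    then obtain c where c: "\<forall>j<l. g $ j = (\<Sum>i\<in>T. c i * f i $ j)" by blast
    have "(\<Sum>i\<in>T. (c(a := 0)) i * f i $ j) = (\<Sum>i\<in>T. c i * f i $ j)" for j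
      using insert.hyps by (intro sum.cong) auto
    with c insert.hyps show ?thesis by (intro exI[of _ "c(a := 0)"]) simp
  next
    case True
    then obtain y where y: "y \<in> carrier_vec l" "\<And>i. i \<in> T \<Longrightarrow> f i \<bullet> y = 0" "f a \<bullet> y \<noteq> 0"
      by blast
    \<comment> \<open>With this coefficient \<open>g - b \<cdot>\<^sub>v f a\<close> vanishes at
      \<open>y\<close>.\<close>
    define b where "b = (g \<bullet> y) / (f a \<bullet> y)"
    have "\<exists>c. \<forall>j<l. (g - b \<cdot>\<^sub>v f a) $ j = (\<Sum>i\<in>T. c i * f i $ j)"
    proof (rule insert.IH)
      fix z assume z: "z \<in> carrier_vec l" "\<And>i. i \<in> T \<Longrightarrow> f i \<bullet> z = 0"
      \<comment> \<open>Moving \<open>z\<close> along \<open>y\<close> by \<open>s\<close> makes it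
        a zero of \<open>f a\<close> too, and it stays a zero of the functionals from
        \<open>T\<close> because \<open>y\<close> is one. So \<open>van\<close> applies to
        \<open>z - s \<cdot>\<^sub>v y\<close>.\<close>
      define s where "s = (f a \<bullet> z) / (f a \<bullet> y)"
      have sp: "h \<bullet> (z - s \<cdot>\<^sub>v y) = h \<bullet> z - s * (h \<bullet> y)" if "h \<in> carrier_vec l" for h
        using that z(1) y(1) by (simp add: scalar_prod_minus_distrib)
      have "g \<bullet> (z - s \<cdot>\<^sub>v y) = 0"
      proof (rule van)
        fix i assume i: "i \<in> insert a T"
        then have "f i \<in> carrier_vec l" using fc by simp
        then show "f i \<bullet> (z - s \<cdot>\<^sub>v y) = 0"
          using i z(2) y(2,3)
          unfolding sp[OF \<open>f i \<in> carrier_vec l\<close>] by (auto simp: s_def)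
      qed (use z(1) y(1) in auto)
      then have "g \<bullet> z = s * (g \<bullet> y)" using gc by (simp add: sp)
      then show "(g - b \<cdot>\<^sub>v f a) \<bullet> z = 0"
        using gc fa z(1) by (simp add: minus_scalar_prod_distrib s_def b_def)
    qed (use fc gc in auto)
    then obtain c where c: "\<forall>j<l. (g - b \<cdot>\<^sub>v f a) $ j = (\<Sum>i\<in>T. c i * f i $ j)" by blast
    have "(\<Sum>i\<in>T. (c(a := b)) i * f i $ j) = (\<Sum>i\<in>T. c i * f i $ j)" for j
      using insert.hyps by (intro sum.cong) auto
    moreover have "g $ j = b * f a $ j + (\<Sum>i\<in>T. c i * f i $ j)" if "j < l" for j
      using c[rule_format, OF that] gc fa that by (simp add: algebra_simps)
    ultimately show ?thesis using insert.hyps by (intro exI[of _ "c(a := b)"]) simp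
  qed
qed

text \<open>The kernel hypothesis says that the columns of \<open>A\<close> indexed by
  \<open>S\<close> are linearly independent, so any values on \<open>S\<close> are attained by a
  combination of the rows. The induction repairs one further position \<open>a\<close> at a time
  without disturbing the earlier ones.\<close>

lemma row_mult_onto:
  fixes A :: "'a::field mat"
  assumes A: "A \<in> carrier_mat l n" and "finite S" "S \<subseteq> {..<n}"
    and "\<And>v. v \<in> mat_kernel A \<Longrightarrow> (\<And>j. j < n \<Longrightarrow> j \<notin> S \<Longrightarrow> v $ j = 0) \<Longrightarrow> v = 0\<^sub>v n"
  shows "\<exists>z\<in>carrier_vec l. \<forall>i\<in>S. (z \<^sub>v* A) $ i = f i"
  using assms(2-)
proof (induction S rule: finite_induct)
  case empty
  then show ?case by (intro bexI[of _ "0\<^sub>v l"]) auto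
next
  case (insert a S)
  then have S: "S \<subseteq> {..<n}" "a < n" by auto
  have ker: "v = 0\<^sub>v n" if "v \<in> mat_kernel A" "\<And>j. j < n \<Longrightarrow> j \<notin> insert a S \<Longrightarrow> v $ j = 0" for v
    using insert.prems(2) that by blast
  have "\<exists>z\<in>carrier_vec l. \<forall>i\<in>S. (z \<^sub>v* A) $ i = f i"
    by (rule insert.IH) (use S ker in auto)
  then obtain z where z: "z \<in> carrier_vec l" "\<And>i. i \<in> S \<Longrightarrow> (z \<^sub>v* A) $ i = f i" by blast
  \<comment> \<open>Without such a \<open>y\<close>, column \<open>a\<close> would, by duality, be a
    combination of the columns in \<open>S\<close>.\<close>
  have "\<exists>y\<in>carrier_vec l. (\<forall>i\<in>S. (y \<^sub>v* A) $ i = 0) \<and> (y \<^sub>v* A) $ a \<noteq> 0"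
  proof (rule ccontr)
    assume "\<not> ?thesis"
    then have "\<exists>c. \<forall>j<l. col A a $ j = (\<Sum>i\<in>S. c i * col A i $ j)"
      using A S insert.hyps by (intro mem_span_of_vanishing) (auto simp: index_row_mult subset_eq)
    then obtain c where c: "\<And>j. j < l \<Longrightarrow> col A a $ j = (\<Sum>i\<in>S. c i * col A i $ j)" by blast
    \<comment> \<open>The column relation written as a kernel vector: it is supported on
      \<open>insert a S\<close> and equals 1 at \<open>a\<close>, which contradicts
      \<open>ker\<close>.\<close>
    define v where "v = vec n (\<lambda>i. if i = a then 1 else if i \<in> S then - c i else 0)"
    have "A *\<^sub>v v = 0\<^sub>v l"
    proof (rule eq_vecI)
      fix j assume "j < dim_vec (0\<^sub>v l)"
      then have j: "j < l" by simp
      have "(A *\<^sub>v v) $ j = (\<Sum>i\<in>{..<n}. A $$ (j, i) * v $ i)"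
        using A j by (auto simp: scalar_prod_def v_def atLeast0LessThan)
      also have "\<dots> = (\<Sum>i\<in>insert a S. A $$ (j, i) * v $ i)"
        using S by (intro sum.mono_neutral_right) (auto simp: v_def)
      also have "\<dots> = A $$ (j, a) + (\<Sum>i\<in>S. - (c i * A $$ (j, i)))"
        using insert.hyps S by (auto simp: v_def intro!: sum.cong arg_cong2[of _ _ _ _ "(+)"])
      also have "\<dots> = 0"
        using c[OF j] A S j by (auto simp: sum_negf subset_eq)
      finally show "(A *\<^sub>v v) $ j = 0\<^sub>v l $ j" using j by simp
    qed (use A in auto)
    then have "v \<in> mat_kernel A" using A by (intro mat_kernelI) (auto simp: v_def)
    moreover have "v $ j = 0" if "j < n" "j \<notin> insert a S" for j
      using that by (simp add: v_def)
    ultimately have "v = 0\<^sub>v n" using ker by blast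
    then have "v $ a = 0" using S by simp
    then show False using S by (simp add: v_def)
  qed
  then obtain y where y: "y \<in> carrier_vec l" "\<And>i. i \<in> S \<Longrightarrow> (y \<^sub>v* A) $ i = 0" "(y \<^sub>v* A) $ a \<noteq> 0"
    by blast
  \<comment> \<open>Adding \<open>b\<close> times \<open>y\<close> corrects the entry at
    \<open>a\<close>; on \<open>S\<close> the product of \<open>y\<close> with \<open>A\<close> is
    zero.\<close>
  define b where "b = (f a - (z \<^sub>v* A) $ a) / ((y \<^sub>v* A) $ a)"
  have "((z + b \<cdot>\<^sub>v y) \<^sub>v* A) $ i = (z \<^sub>v* A) $ i + b * (y \<^sub>v* A) $ i" if "i < n" for i
  proof -
    have "(z + b \<cdot>\<^sub>v y) \<^sub>v* A = z \<^sub>v* A + b \<cdot>\<^sub>v (y \<^sub>v* A)"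
      using A y(1) z(1) by (simp add: row_mult_add_left row_mult_smult_left)
    then show ?thesis using A that by (simp add: row_mult_def)
  qed
  then show ?case using S y z
    by (intro bexI[of _ "z + b \<cdot>\<^sub>v y"]) (auto simp: b_def subset_eq)
qed

section \<open>Hamming distance and unique decoding\<close>

lemma hamming_dist_triangle:
  assumes "u \<in> carrier_vec N" "v \<in> carrier_vec N" "w \<in> carrier_vec N"
  shows "hamming_dist u w \<le> hamming_dist u v + hamming_dist v w"
proof -
  have "card {i. i < N \<and> u $ i \<noteq> w $ i}
      \<le> card ({i. i < N \<and> u $ i \<noteq> v $ i} \<union> {i. i < N \<and> v $ i \<noteq> w $ i})"
    by (intro card_mono) auto
  also have "\<dots> \<le> card {i. i < N \<and> u $ i \<noteq> v $ i} + card {i. i < N \<and> v $ i \<noteq> w $ i}"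
    by (rule card_Un_le)
  finally show ?thesis using assms by (simp add: hamming_dist_def)
qed

lemma hamming_dist_commute:
  "dim_vec v = dim_vec w \<Longrightarrow> hamming_dist v w = hamming_dist w v"
  unfolding hamming_dist_def by metis

lemma min_dist_le: "v \<in> C \<Longrightarrow> w \<in> C \<Longrightarrow> v \<noteq> w \<Longrightarrow> min_dist C \<le> hamming_dist v w"
  unfolding min_dist_def by (intro cInf_lower) auto

text \<open>Two codewords within distance \<open>t\<close> of the same word are at most
  \<open>2 * t\<close> apart, which is below the minimum distance, so they coincide.\<close>

lemma bounded_dist_decode_eq:
  fixes e :: "'a::field vec"
  assumes "C \<subseteq> carrier_vec N" "min_dist C \<ge> 2 * t + 1"
    and "c \<in> C" "e \<in> carrier_vec N" "hamming_weight e \<le> t"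
  shows "bounded_dist_decode t C (c + e) = c"
  unfolding bounded_dist_decode_def
proof (rule the_equality)
  have c: "c \<in> carrier_vec N" using assms by auto
  have "{i. i < N \<and> (c + e) $ i \<noteq> c $ i} = {i. i < N \<and> e $ i \<noteq> 0}"
    using c assms(4) by auto
  then have dce: "hamming_dist (c + e) c \<le> t"
    using c assms(4,5) by (simp add: hamming_dist_def hamming_weight_def)
  then show "c \<in> C \<and> hamming_dist (c + e) c \<le> t" using assms(3) by simp
  fix v assume v: "v \<in> C \<and> hamming_dist (c + e) v \<le> t"
  have vc: "v \<in> carrier_vec N" using v assms(1) by auto
  have "hamming_dist v c \<le> hamming_dist v (c + e) + hamming_dist (c + e) c"
    using vc c assms(4) by (intro hamming_dist_triangle) auto
  also have "\<dots> \<le> t + t"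
    using v dce vc c assms(4) hamming_dist_commute[of v "c + e"] by auto
  finally have "hamming_dist v c < min_dist C" using assms(2) by simp
  then show "v = c" using min_dist_le[of v C c] v assms(3) by fastforce
qed

text \<open>A nonzero kernel vector supported on \<open>S\<close> would be a codeword at distance at
  most \<open>card S\<close> from the zero word. This supplies the independence hypothesis of
  \<open>row_mult_onto\<close>.\<close>

lemma kernel_vec_eq_zero:
  fixes A :: "'a::field mat"
  assumes A: "A \<in> carrier_mat l n" and S: "finite S" "card S < min_dist (mat_kernel A)"
    and v: "v \<in> mat_kernel A" "\<And>j. j < n \<Longrightarrow> j \<notin> S \<Longrightarrow> v $ j = 0"
  shows "v = 0\<^sub>v n"
proof (rule ccontr)
  assume "v \<noteq> 0\<^sub>v n"
  moreover have "0\<^sub>v n \<in> mat_kernel A" using A by (intro mat_kernelI) auto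
  ultimately have "min_dist (mat_kernel A) \<le> hamming_dist v (0\<^sub>v n)"
    using v(1) by (intro min_dist_le)
  also have "\<dots> \<le> card S"
    unfolding hamming_dist_def using v mat_kernelD(1)[OF A v(1)] S(1) by (intro card_mono) force+
  finally show False using S(2) by simp
qed

section \<open>Characteristic two and the embedding of bits\<close>

text \<open>Translation by 1 permutes the ring, so the sum of all elements is unchanged when 1 is
  added to each of them.\<close>

lemma of_nat_card_UNIV_eq_0: "of_nat (card (UNIV :: 'a::{finite,ring_1} set)) = (0 :: 'a)"
proof -
  have "(\<Sum>y\<in>(UNIV :: 'a set). y + 1) = (\<Sum>y\<in>UNIV. y)"
    by (rule sum.reindex_bij_witness[of _ "\<lambda>y. y - 1" "\<lambda>y. y + 1"]) auto
  then show ?thesis by (simp add: sum.distrib)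
qed

lemma two_eq_0:
  assumes "card (UNIV :: 'a::{finite,field} set) = 2 ^ lam"
  shows "(2 :: 'a) = 0"
proof -
  have "(2 :: 'a) ^ lam = of_nat (card (UNIV :: 'a set))" using assms by simp
  also have "\<dots> = 0" by (rule of_nat_card_UNIV_eq_0)
  finally show ?thesis by simp
qed

lemma of_bit_add: "(2 :: 'a::field) = 0 \<Longrightarrow> (of_bit (a + b) :: 'a) = of_bit a + of_bit b"
  by (cases a; cases b) simp_all

lemma of_bit_mult: "(of_bit (a * b) :: 'a::semiring_1) = of_bit a * of_bit b"
  by (cases a; cases b) simp_all

lemma of_bit_sum:
  assumes "(2 :: 'a::field) = 0"
  shows "(of_bit (sum f A) :: 'a) = (\<Sum>i\<in>A. of_bit (f i))"
proof (induction A rule: infinite_finite_induct)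
  case (insert a A)
  then show ?case
    unfolding sum.insert[OF insert.hyps] of_bit_add[OF assms] by (simp only:)
qed simp_all

text \<open>In characteristic 2 \<open>of_bit\<close> respects sums and products. Thus a mask found
  by linear algebra over the bits gives the same entries over the big field.\<close>

lemma lift_vec_row_mult:
  assumes "(2 :: 'a::field) = 0" "A \<in> carrier_mat nr nc" "z \<in> carrier_vec nr"
  shows "(lift_vec (z \<^sub>v* A) :: 'a vec) = lift_vec z \<^sub>v* lift_mat A"
proof (rule eq_vecI)
  fix j assume "j < dim_vec (lift_vec z \<^sub>v* lift_mat A :: 'a vec)"
  then have j: "j < nc" using assms(2) by (simp add: row_mult_def lift_mat_def)
  have "(z \<^sub>v* A) $ j = (\<Sum>i<nr. A $$ (i, j) * z $ i)"
    using assms(2,3) j by (auto simp: index_row_mult scalar_prod_def atLeast0LessThan)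
  then have "(lift_vec (z \<^sub>v* A) :: 'a vec) $ j = of_bit (\<Sum>i<nr. A $$ (i, j) * z $ i)"
    using assms(2) j by (simp add: lift_vec_def row_mult_def)
  also have "\<dots> = (\<Sum>i<nr. of_bit (A $$ (i, j) * z $ i))"
    by (rule of_bit_sum[OF assms(1)])
  also have "\<dots> = (\<Sum>i<nr. of_bit (A $$ (i, j)) * of_bit (z $ i))"
    by (simp only: of_bit_mult)
  also have "\<dots> = (lift_vec z \<^sub>v* lift_mat A :: 'a vec) $ j"
    using assms(2,3) j
    by (auto simp: lift_vec_def lift_mat_def row_mult_def scalar_prod_def atLeast0LessThan)
  finally show "(lift_vec (z \<^sub>v* A) :: 'a vec) $ j = (lift_vec z \<^sub>v* lift_mat A) $ j" .
qed (use assms(2) in \<open>simp add: lift_vec_def lift_mat_def row_mult_def\<close>)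

lemma lift_mat_append_cols:
  assumes "A \<in> carrier_mat nr nc1" "B \<in> carrier_mat nr nc2"
  shows "lift_mat (A @\<^sub>c B) = lift_mat A @\<^sub>c lift_mat B"
  using assms by (intro eq_matI) (auto simp: lift_mat_def append_cols_def)

lemma lift_mat_one: "lift_mat (1\<^sub>m l) = 1\<^sub>m l"
  by (rule eq_matI) (auto simp: lift_mat_def)

lemma lift_mat_carrier [simp, intro]:
  "A \<in> carrier_mat nr nc \<Longrightarrow> lift_mat A \<in> carrier_mat nr nc"
  by (simp add: lift_mat_def)

lemma lift_vec_carrier [simp, intro]: "v \<in> carrier_vec n \<Longrightarrow> lift_vec v \<in> carrier_vec n"
  by (simp add: lift_vec_def)

section \<open>Block form of the products with the generator matrix\<close>

lemma H0_mat_carrier [intro]: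
  assumes "R \<in> carrier_mat l s" shows "H0_mat l R \<in> carrier_mat l (l + s)"
  using assms by (auto simp: H0_mat_def)

lemma H0_ext_carrier [intro]:
  assumes "R \<in> carrier_mat l s" shows "H0_ext l R \<in> carrier_mat l (l + s + 1)"
  unfolding H0_ext_def
  by (intro append_cols_carrier lift_mat_carrier H0_mat_carrier assms zero_carrier_mat)

lemma G1_ext_carrier [intro]:
  assumes "P \<in> carrier_mat k r" shows "G1_ext l k P \<in> carrier_mat k (l + (k + r) + 1)"
  using assms unfolding G1_ext_def G1_mat_def by (intro append_cols_carrier) auto

lemma row_mult_H0_ext_lift:
  fixes a :: "'a::field vec"
  assumes "R \<in> carrier_mat l s" "a \<in> carrier_vec l"
  shows "a \<^sub>v* H0_ext l R = (a \<^sub>v* lift_mat (H0_mat l R)) @\<^sub>v 0\<^sub>v 1"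
  unfolding H0_ext_def using assms(2) H0_mat_carrier[OF assms(1)]
  by (subst row_mult_append_cols[where nr = l]) auto

text \<open>Systematic form: the first \<open>l\<close> entries return \<open>a\<close> itself,
  which is what the decoder reads off.\<close>

lemma row_mult_H0_ext:
  fixes a :: "'a::field vec"
  assumes "R \<in> carrier_mat l s" "a \<in> carrier_vec l"
  shows "a \<^sub>v* H0_ext l R = (a @\<^sub>v (a \<^sub>v* lift_mat R)) @\<^sub>v 0\<^sub>v 1"
  unfolding row_mult_H0_ext_lift[OF assms] H0_mat_def using assms
  by (simp add: lift_mat_append_cols[OF one_carrier_mat assms(1)] lift_mat_one
      row_mult_append_cols[OF one_carrier_mat lift_mat_carrier[OF assms(1)] assms(2)])

lemma row_mult_G1_ext:
  fixes b :: "'a::field vec"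
  assumes "P \<in> carrier_mat k r" "b \<in> carrier_vec k"
  shows "b \<^sub>v* G1_ext l k P = (0\<^sub>v l @\<^sub>v (b @\<^sub>v (b \<^sub>v* P))) @\<^sub>v 0\<^sub>v 1"
proof -
  have 1: "1\<^sub>m k @\<^sub>c P \<in> carrier_mat k (k + r)" using assms by auto
  have 2: "0\<^sub>m k l @\<^sub>c 1\<^sub>m k @\<^sub>c P \<in> carrier_mat k (l + (k + r))" using 1 by auto
  show ?thesis unfolding G1_ext_def G1_mat_def
    using assms(2)
    by (simp add: row_mult_append_cols[OF 2 zero_carrier_mat assms(2)]
        row_mult_append_cols[OF zero_carrier_mat 1 assms(2)]
        row_mult_append_cols[OF one_carrier_mat assms])
qed

section \<open>Coordinates over the two-element field\<close>

locale binary_basis =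
  fixes lam :: nat and x :: "'a::{finite,field}"
  assumes char_two: "(2 :: 'a) = 0"
    and basis: "binary_power_basis lam x"
    and lam_pos: "lam > 0"
begin

abbreviation "F \<equiv> zero_const_elems lam x"

lemma add_self [simp]: "(a :: 'a) + a = 0"
  using char_two by (metis mult_2 mult_zero_left)

lemma add_self_cancel [simp]: "(a :: 'a) + (a + b) = b" "(b + a) + a = (b :: 'a)"
  by (simp_all add: add.assoc[of b] flip: add.assoc[of a a])

lemma uminus_eq [simp]: "- (a :: 'a) = a"
  by (metis add_self minus_unique)

lemma binary_coords_comb:
  assumes "a \<in> carrier_vec lam" shows "binary_coords lam x (binary_comb lam x a) = a"
  unfolding binary_coords_def
  using assms basis unfolding binary_power_basis_def by (intro the_equality) auto

lemma binary_coords: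
  "binary_coords lam x y \<in> carrier_vec lam" "binary_comb lam x (binary_coords lam x y) = y"
  using basis binary_coords_comb unfolding binary_power_basis_def by metis+

lemma binary_comb_add:
  assumes "a \<in> carrier_vec lam" "b \<in> carrier_vec lam"
  shows "binary_comb lam x (a + b) = binary_comb lam x a + binary_comb lam x b"
  unfolding binary_comb_def sum.distrib[symmetric] using assms
  by (intro sum.cong) (auto simp: of_bit_add[OF char_two] ring_distribs simp del: even_add)

lemma binary_comb_split:
  "binary_comb lam x a = of_bit (a $ 0) + (\<Sum>i=1..<lam. of_bit (a $ i) * x ^ i)"
proof -
  have "binary_comb lam x a = (\<Sum>i=0..<lam. of_bit (a $ i) * x ^ i)"
    by (simp add: binary_comb_def atLeast0LessThan)
  also have "\<dots> = of_bit (a $ 0) * x ^ 0 + (\<Sum>i=Suc 0..<lam. of_bit (a $ i) * x ^ i)"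
    using lam_pos by (rule sum.atLeast_Suc_lessThan)
  finally show ?thesis by simp
qed

lemma mem_F_iff: "y \<in> F \<longleftrightarrow> binary_coords lam x y $ 0 = 0"
proof
  assume "y \<in> F"
  then obtain a where "y = binary_comb lam x a" "a \<in> carrier_vec lam" "a $ 0 = 0"
    unfolding zero_const_elems_def by blast
  then show "binary_coords lam x y $ 0 = 0" by (simp add: binary_coords_comb)
next
  assume "binary_coords lam x y $ 0 = 0"
  then show "y \<in> F" unfolding zero_const_elems_def using binary_coords[of y] by force
qed

lemma coords_add:
  "binary_coords lam x (y + z) = binary_coords lam x y + binary_coords lam x z"
  by (metis add_carrier_vec binary_comb_add binary_coords binary_coords_comb)

lemma coords_one: "binary_coords lam x 1 = unit_vec lam 0"
proof -
  have "binary_comb lam x (unit_vec lam 0) = 1 + (\<Sum>i=1..<lam. 0)"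
    unfolding binary_comb_split using lam_pos by (intro arg_cong2[of _ _ _ _ "(+)"] sum.cong) auto
  then show ?thesis using binary_coords_comb[of "unit_vec lam 0"] by simp
qed

lemma dim_coords [simp]: "dim_vec (binary_coords lam x y) = lam"
  using binary_coords(1) by auto

text \<open>The coordinates of 1 form the first unit vector, so adding 1 flips exactly coordinate
  0.\<close>

lemma mem_F_add_one_iff: "y + 1 \<in> F \<longleftrightarrow> y \<notin> F"
  using lam_pos by (auto simp: mem_F_iff coords_add coords_one)

lemma F_add: "y \<in> F \<Longrightarrow> z \<in> F \<Longrightarrow> y + z \<in> F"
  using lam_pos by (auto simp: mem_F_iff coords_add)

lemma zero_mem_F: "0 \<in> F"
  using F_add mem_F_add_one_iff[of 0] mem_F_add_one_iff[of 1] by fastforce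

lemma F_add_one_neq_0: "\<zeta> \<in> F \<Longrightarrow> \<zeta> + 1 \<noteq> 0"
  using mem_F_add_one_iff zero_mem_F by metis

text \<open>A bit affects only coordinate 0, which \<open>drop_const\<close> discards and which is
  zero for \<open>y\<close>. This is how the decoder gets rid of the mask.\<close>

lemma drop_const_add_bit:
  assumes "y \<in> F" shows "drop_const lam x (y + of_bit b) = y"
proof -
  let ?c = "binary_coords lam x"
  have "drop_const lam x (y + of_bit b) = (\<Sum>i=1..<lam. of_bit (?c y $ i) * x ^ i)"
    unfolding drop_const_def
    by (cases b; intro sum.cong) (auto simp: coords_add coords_one)
  also have "\<dots> = binary_comb lam x (?c y)"
    using assms by (simp add: binary_comb_split mem_F_iff)
  finally show ?thesis by (simp add: binary_coords)
qed

lemma card_F: "2 * card F = card (UNIV :: 'a set)"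
proof -
  have "bij_betw (\<lambda>y. y + 1) F (- F)"
    by (rule bij_betwI[where g = "\<lambda>y. y + 1"]) (auto simp: mem_F_add_one_iff add.assoc)
  then have "card (- F) = card F" by (simp add: bij_betw_same_card)
  moreover have "card (UNIV :: 'a set) = card F + card (- F)"
    using card_Un_disjoint[of F "- F"] by simp
  ultimately show ?thesis by simp
qed

text \<open>Double counting of the pairs of a shift and a position: each position is counted once,
  so the counts sum to \<open>card \<phi>\<close> and some shift is at most average. The product
  form avoids dividing by \<open>card F\<close>.\<close>

lemma exists_shift_few_bits:
  assumes "finite \<phi>"
  shows "\<exists>\<zeta>\<in>F. card {i \<in> \<phi>. f i + \<zeta> \<in> {0, 1}} * card F \<le> card \<phi>"
proof (rule ccontr)
  assume "\<not> ?thesis"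
  then have big: "card \<phi> < card {i \<in> \<phi>. f i + \<zeta> \<in> {0, 1}} * card F" if "\<zeta> \<in> F" for \<zeta>
    using that by force
  have one: "card {\<zeta> \<in> F. f i + \<zeta> \<in> {0, 1}} = 1" for i
  proof -
    \<comment> \<open>In characteristic 2 the only candidates are \<open>f i\<close> and
      \<open>f i + 1\<close>, and exactly one of them lies in \<open>F\<close>.\<close>
    have "{\<zeta> \<in> F. f i + \<zeta> \<in> {0, 1}} = {if f i \<in> F then f i else f i + 1}"
    proof (intro Set.set_eqI iffI)
      fix \<zeta> assume "\<zeta> \<in> {\<zeta> \<in> F. f i + \<zeta> \<in> {0, 1}}"
      then have z: "\<zeta> \<in> F" "f i + \<zeta> = 0 \<or> f i + \<zeta> = 1" by auto
      have "f i = (f i + \<zeta>) + \<zeta>" by simp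
      then have "f i = \<zeta> \<or> f i = \<zeta> + 1" using z(2) by (metis add.commute add_0)
      then show "\<zeta> \<in> {if f i \<in> F then f i else f i + 1}"
        using mem_F_add_one_iff[of \<zeta>] z(1) by auto
    next
      fix \<zeta> assume z: "\<zeta> \<in> {if f i \<in> F then f i else f i + 1}"
      show "\<zeta> \<in> {\<zeta> \<in> F. f i + \<zeta> \<in> {0, 1}}"
        using z mem_F_add_one_iff[of "f i"] by (cases "f i \<in> F") auto
    qed
    then show ?thesis by simp
  qed
  have "(\<Sum>\<zeta>\<in>F. card {i \<in> \<phi>. f i + \<zeta> \<in> {0, 1}}) = (\<Sum>i\<in>\<phi>. card {\<zeta> \<in> F. f i + \<zeta> \<in> {0, 1}})"
    using assms by (intro sum_multicount_gen) auto
  also have "\<dots> = card \<phi>" using one by simp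
  finally have "card F * card \<phi> = (\<Sum>\<zeta>\<in>F. card {i \<in> \<phi>. f i + \<zeta> \<in> {0, 1}} * card F)"
    unfolding sum_distrib_right[symmetric] by (simp only: mult.commute)
  \<comment> \<open>Strictness of the sum needs \<open>F\<close> to be nonempty, hence
    \<open>zero_mem_F\<close>.\<close>
  moreover have "(\<Sum>\<zeta>\<in>F. card \<phi>) < (\<Sum>\<zeta>\<in>F. card {i \<in> \<phi>. f i + \<zeta> \<in> {0, 1}} * card F)"
    using big zero_mem_F by (intro sum_strict_mono) auto
  ultimately show False by simp
qed

section \<open>Counting messages and inverting the encoding\<close>

lemma card_messages:
  assumes "card (UNIV :: 'a set) = 2 ^ lam"
  shows "finite (messages lam x k l)" "card (messages lam x k l) = 2 ^ (lam * (k + l) - l)"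
proof -
  have cF: "card F = 2 ^ (lam - 1)"
    using card_F assms lam_pos by (cases lam) auto
  \<comment> \<open>Vectors are identified with lists so that the counting of lists of fixed length
    applies.\<close>
  have bij: "bij_betw (\<lambda>v. map (\<lambda>i. v $ i) [0..<N]) {v \<in> carrier_vec N. \<forall>i<N. v $ i \<in> B}
        {xs. set xs \<subseteq> B \<and> length xs = N}" for N and B :: "'a set"
  proof (rule bij_betwI[where g = "\<lambda>xs. vec N ((!) xs)"])
    show "(\<lambda>xs. vec N ((!) xs)) \<in> {xs. set xs \<subseteq> B \<and> length xs = N}
        \<rightarrow> {v \<in> carrier_vec N. \<forall>i<N. v $ i \<in> B}"
      using nth_mem by fastforce
    show "vec N ((!) (map (\<lambda>i. v $ i) [0..<N])) = v"
      if "v \<in> {v \<in> carrier_vec N. \<forall>i<N. v $ i \<in> B}" for v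
      using that by (intro eq_vecI) auto
    show "map (\<lambda>i. vec N ((!) xs) $ i) [0..<N] = xs"
      if "xs \<in> {xs. set xs \<subseteq> B \<and> length xs = N}" for xs
      using that by (intro nth_equalityI) auto
  qed auto
  have card_vecs: "finite {v \<in> carrier_vec N. \<forall>i<N. v $ i \<in> B}"
       "card {v \<in> carrier_vec N. \<forall>i<N. v $ i \<in> B} = card B ^ N" for N and B :: "'a set"
    using bij_betw_finite[OF bij] bij_betw_same_card[OF bij]
    by (simp_all add: finite_lists_length_eq card_lists_length_eq)
  have "finite (carrier_vec k :: 'a vec set)" "card (carrier_vec k :: 'a vec set) = (2 ^ lam) ^ k"
    using card_vecs[of k UNIV] assms by auto
  moreover have "lam * k + (lam - 1) * l = lam * (k + l) - l"
    using lam_pos by (cases lam) (simp_all add: algebra_simps)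
  ultimately show "finite (messages lam x k l)"
    "card (messages lam x k l) = 2 ^ (lam * (k + l) - l)"
    unfolding messages_def using card_vecs[of l F] cF
    by (simp_all add: card_cartesian_product power_mult[symmetric] power_add[symmetric])
qed

text \<open>The two extended matrices have a zero last column, so entry \<open>n\<close> of the
  decoded word is \<open>a\<close> and the decoder cancels the shift. The first \<open>l\<close>
  entries then show \<open>m'\<close> plus the mask, and removing that combination of the rows of
  \<open>H0_ext\<close> exposes \<open>m\<close>. The coefficient \<open>a\<close> may be
  arbitrary.\<close>

lemma decoder_correct:
  assumes R: "R \<in> carrier_mat l (k + r)" and P: "P \<in> carrier_mat k r"
    and n: "n = l + (k + r)"
    and m: "m \<in> carrier_vec k"
    and m': "m' \<in> carrier_vec l" "\<And>i. i < l \<Longrightarrow> m' $ i \<in> F"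
    and z: "z \<in> carrier_vec l"
    and dec: "bounded_dist_decode t C y
        = (m' + lift_vec z) \<^sub>v* H0_ext l R + m \<^sub>v* G1_ext l k P + a \<cdot>\<^sub>v ones_vec (n + 1)"
  shows "decoder n l k t lam x C R y = (m, m')"
proof -
  \<comment> \<open>This is the decoder's \<open>m''\<close>: the mask is still added to
    \<open>m'\<close>.\<close>
  define s where "s = m' + lift_vec z"
  have s: "s \<in> carrier_vec l" using m' z by (simp add: s_def)
  define h where "h = s \<^sub>v* H0_ext l R"
  define g where "g = m \<^sub>v* G1_ext l k P"
  have h_eq: "h = (s @\<^sub>v (s \<^sub>v* lift_mat R)) @\<^sub>v 0\<^sub>v 1"
    unfolding h_def by (rule row_mult_H0_ext[OF R s])
  have g_eq: "g = (0\<^sub>v l @\<^sub>v (m @\<^sub>v (m \<^sub>v* P))) @\<^sub>v 0\<^sub>v 1"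
    unfolding g_def by (rule row_mult_G1_ext[OF P m])
  have dims: "dim_vec s = l" "dim_vec m = k" "dim_vec (s \<^sub>v* lift_mat R) = k + r"
    "dim_vec (m \<^sub>v* P) = r"
    using s m R P by (auto simp: row_mult_def lift_mat_def)
  have hc: "h \<in> carrier_vec (n + 1)" and gc: "g \<in> carrier_vec (n + 1)"
    unfolding h_eq g_eq using dims n by (auto intro!: carrier_vecI)
  have hn: "h $ n = 0" "g $ n = 0" and hl: "\<And>i. i < l \<Longrightarrow> h $ i = s $ i" "\<And>i. i < l \<Longrightarrow> g $ i = 0"
    and gm: "\<And>i. i < k \<Longrightarrow> g $ (l + i) = m $ i"
    unfolding h_eq g_eq using dims n by auto
  define v where "v = bounded_dist_decode t C y"
  have v: "v = h + g + a \<cdot>\<^sub>v ones_vec (n + 1)"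
    unfolding v_def h_def g_def s_def by (rule dec)
  have ones: "(ones_vec (n + 1) :: 'a vec) \<in> carrier_vec (n + 1)"
    "\<And>i. i < n + 1 \<Longrightarrow> (ones_vec (n + 1) :: 'a vec) $ i = 1"
    by (auto simp: ones_vec_def)
  have v': "v - v $ n \<cdot>\<^sub>v ones_vec (n + 1) = h + g"
    using hc gc ones hn by (intro eq_vecI) (auto simp: v)
  have hg: "vec l (\<lambda>i. (h + g) $ i) = s"
    using hc gc s hl n by (intro eq_vecI) auto
  have v'': "(h + g) - s \<^sub>v* H0_ext l R = g"
    unfolding h_def[symmetric] using hc gc by (intro eq_vecI) auto
  have "map_vec (drop_const lam x) s = m'"
  proof (rule eq_vecI)
    fix i assume "i < dim_vec m'"
    then have i: "i < l" using m'(1) by simp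
    then have "s $ i = m' $ i + of_bit (z $ i)" using m'(1) z by (simp add: s_def lift_vec_def)
    then show "map_vec (drop_const lam x) s $ i = m' $ i"
      using i dims(1) drop_const_add_bit[OF m'(2)[OF i]] by simp
  qed (use dims m' in simp)
  moreover have "vec k (\<lambda>i. g $ (l + i)) = m"
    using gm m by (intro eq_vecI) auto
  ultimately show ?thesis
    unfolding decoder_def Let_def v_def[symmetric] v' hg v'' by simp
qed

end

section \<open>Admissible choices exist and the scheme corrects errors\<close>

text \<open>Encoding involves choices, so \<open>enc\<close> ranges over all functions that select
  admissible outputs. The first conjunct shows that such functions exist and that no admissible
  \<open>\<zeta>\<close> leads to a dead end.\<close>

theorem theorem1:
  fixes n u t lam k k\<^sub>1 r l u\<^sub>0 d\<^sub>0 d :: nat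
    and x :: "'a::{finite,field}"
    and leq :: "'a rel"
    and P :: "'a mat" and R :: "bit mat"
    and C\<^sub>0 :: "bit vec set" and C :: "'a vec set"
  assumes "card (UNIV :: 'a set) = 2 ^ lam"
    and "level_order leq"
    and "binary_power_basis lam x"
    and "n > 0" "u > 0" "t > 0" "lam > 1" "k > 0" "k\<^sub>1 > 0" "r > 0" "l > 0"
    and "u \<le> n" "t \<le> n"
    and "int k\<^sub>1 = int n - int l - int r"
    and "k = l + k\<^sub>1 + 1"
    and "u\<^sub>0 = nat \<lfloor>2 * real u / 2 ^ lam\<rfloor>"
    and "P \<in> carrier_mat k\<^sub>1 r"
    and "R \<in> carrier_mat l (n - l)"
    and "parity_check_matrix (H0_mat l R) C\<^sub>0"
    and "linear_code n (k\<^sub>1 + r) C\<^sub>0"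
    and "min_dist C\<^sub>0 = d\<^sub>0" "d\<^sub>0 \<ge> u\<^sub>0 + 1"
    and "generator_matrix (G_mat n l k\<^sub>1 P R) C"
    and "linear_code (n + 1) k C"
    and "min_dist C = d" "d \<ge> 2 * t + 1"
  shows
    "(\<forall>\<phi> \<mu>. \<phi> \<subseteq> {0..n} \<and> card \<phi> = u \<and> \<mu> \<in> messages lam x k\<^sub>1 l \<longrightarrow>
        (\<exists>\<zeta>. zeta_choice n l k\<^sub>1 lam x u\<^sub>0 P R \<phi> \<mu> \<zeta>) \<and>
        (\<forall>\<zeta>. zeta_choice n l k\<^sub>1 lam x u\<^sub>0 P R \<phi> \<mu> \<zeta> \<longrightarrow>
           (\<exists>z. mask_choice l R \<phi> (base_word n l k\<^sub>1 P R \<mu> \<zeta>) z))) \<and>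
     (\<forall>enc.
        (\<forall>\<phi> \<mu>. \<phi> \<subseteq> {0..n} \<and> card \<phi> = u \<and> \<mu> \<in> messages lam x k\<^sub>1 l \<longrightarrow>
           encoder_output n l k\<^sub>1 lam x u\<^sub>0 P R \<phi> \<mu> (enc \<phi> \<mu>)) \<longrightarrow>
        psmc leq 1 u t (n + 1) (2 ^ (lam * (k\<^sub>1 + l) - l)) (messages lam x k\<^sub>1 l)
          enc (decoder n l k\<^sub>1 t lam x C R))"
proof -
  have n: "n = l + (k\<^sub>1 + r)" using assms(14) by linarith
  interpret binary_basis lam x
    using assms(3,7) two_eq_0[OF assms(1)] by unfold_locales auto
  have R: "R \<in> carrier_mat l (k\<^sub>1 + r)" using assms(18) n by simp
  have P: "P \<in> carrier_mat k\<^sub>1 r" by (rule assms(17))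
  have H0c: "H0_mat l R \<in> carrier_mat l n" using H0_mat_carrier[OF R] n by simp
  have Hc: "(H0_ext l R :: 'a mat) \<in> carrier_mat l (n + 1)" using H0_ext_carrier[OF R] n by simp
  have Gc: "G1_ext l k\<^sub>1 P \<in> carrier_mat k\<^sub>1 (n + 1)" using G1_ext_carrier[OF P, of l] n by simp
  have C0: "C\<^sub>0 = mat_kernel (H0_mat l R)"
    using assms(19) by (simp add: parity_check_matrix_def)
  have u0: "u\<^sub>0 < min_dist (mat_kernel (H0_mat l R))" using assms(21,22) C0 by simp
  have ones_n: "(ones_vec (n + 1) :: 'a vec) \<in> carrier_vec (n + 1)"
    "\<And>i. i < n + 1 \<Longrightarrow> (ones_vec (n + 1) :: 'a vec) $ i = 1"
    by (auto simp: ones_vec_def)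

  have wc: "base_word n l k\<^sub>1 P R \<mu> \<zeta> \<in> carrier_vec (n + 1)" for \<mu> \<zeta>
    unfolding base_word_def using Hc Gc ones_n(1) by (cases \<mu>) auto
  \<comment> \<open>Only the multiple of the all-one vector reaches the last position.\<close>
  have wn: "base_word n l k\<^sub>1 P R \<mu> \<zeta> $ n = \<zeta> + 1" if "\<mu> \<in> messages lam x k\<^sub>1 l" for \<mu> \<zeta>
  proof -
    obtain m m' where \<mu>: "\<mu> = (m, m')" by (cases \<mu>)
    then have c: "m \<in> carrier_vec k\<^sub>1" "m' \<in> carrier_vec l"
      using that by (auto simp: messages_def)
    have "(m' \<^sub>v* H0_ext l R) $ n = 0" "(m \<^sub>v* G1_ext l k\<^sub>1 P) $ n = 0"
      unfolding row_mult_H0_ext[OF R c(2)] row_mult_G1_ext[OF P c(1)]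
      using c R P n by (auto simp: row_mult_def lift_mat_def)
    then show ?thesis
      using carrier_vecD[OF row_mult_carrier[OF Hc]] carrier_vecD[OF row_mult_carrier[OF Gc]]
        carrier_vecD[OF ones_n(1)] ones_n(2)[of n]
      by (simp add: base_word_def \<mu>)
  qed
  have mask_at: "(lift_vec z \<^sub>v* H0_ext l R :: 'a vec) $ i
      = (if i < n then of_bit ((z \<^sub>v* H0_mat l R) $ i) else 0)"
    if "z \<in> carrier_vec l" "i < n + 1" for z i
  proof -
    have "(lift_vec z \<^sub>v* H0_ext l R :: 'a vec) = lift_vec (z \<^sub>v* H0_mat l R) @\<^sub>v 0\<^sub>v 1"
      using row_mult_H0_ext_lift[OF R lift_vec_carrier[OF that(1)]]
        lift_vec_row_mult[OF char_two H0c that(1)] by simp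
    then show ?thesis
      using that carrier_vecD[OF row_mult_carrier[OF H0c], of z] by (auto simp: lift_vec_def)
  qed

  have zeta_ex: "\<exists>\<zeta>. zeta_choice n l k\<^sub>1 lam x u\<^sub>0 P R \<phi> \<mu> \<zeta>"
    if \<phi>: "\<phi> \<subseteq> {0..n}" "card \<phi> = u" and \<mu>: "\<mu> \<in> messages lam x k\<^sub>1 l" for \<phi> \<mu>
  proof -
    have fin: "finite \<phi>" using \<phi>(1) finite_subset by blast
    \<comment> \<open>The word for shift 0 already contains the summand 1, so a general
      \<open>\<zeta>\<close> is simply added to it.\<close>
    let ?f = "\<lambda>i. base_word n l k\<^sub>1 P R \<mu> 0 $ i"
    have shift: "base_word n l k\<^sub>1 P R \<mu> \<zeta> $ i = ?f i + \<zeta>" if "i \<in> \<phi>" for i \<zeta>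
    proof -
      have "i < n + 1" using that \<phi>(1) by auto
      then show ?thesis
        using carrier_vecD[OF row_mult_carrier[OF Hc]] carrier_vecD[OF row_mult_carrier[OF Gc]]
          carrier_vecD[OF ones_n(1)] ones_n(2)[of i]
        by (cases \<mu>) (simp add: base_word_def)
    qed
    obtain \<zeta> where \<zeta>: "\<zeta> \<in> F" "card {i \<in> \<phi>. ?f i + \<zeta> \<in> {0, 1}} * card F \<le> u"
      using exists_shift_few_bits[OF fin, of ?f] \<phi>(2) by auto
    let ?b = "card {i \<in> \<phi>. ?f i + \<zeta> \<in> {0, 1}}"
    \<comment> \<open>The averaging bound doubled, since \<open>F\<close> is half of the field;
      dividing and rounding down gives \<open>u\<^sub>0\<close>.\<close>
    have "?b * 2 ^ lam \<le> 2 * u"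
      using \<zeta>(2) unfolding assms(1)[symmetric] card_F[symmetric] by simp
    then have "real (?b * 2 ^ lam) \<le> real (2 * u)" by (rule of_nat_mono)
    then have "real ?b \<le> 2 * real u / 2 ^ lam" by (simp add: field_simps)
    then have "?b \<le> u\<^sub>0" unfolding assms(16) by (rule le_nat_floor)
    moreover have "{i \<in> \<phi>. base_word n l k\<^sub>1 P R \<mu> \<zeta> $ i \<in> {0, 1}} = {i \<in> \<phi>. ?f i + \<zeta> \<in> {0, 1}}"
      using shift[of _ \<zeta>] by auto
    ultimately show ?thesis using \<zeta>(1) unfolding zeta_choice_def by auto
  qed

  have mask_ex: "\<exists>z. mask_choice l R \<phi> (base_word n l k\<^sub>1 P R \<mu> \<zeta>) z"
    if \<phi>: "\<phi> \<subseteq> {0..n}" and \<mu>: "\<mu> \<in> messages lam x k\<^sub>1 l"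
      and \<zeta>: "zeta_choice n l k\<^sub>1 lam x u\<^sub>0 P R \<phi> \<mu> \<zeta>" for \<phi> \<mu> \<zeta>
  proof -
    let ?w = "base_word n l k\<^sub>1 P R \<mu> \<zeta>"
    \<comment> \<open>Position \<open>n\<close> is removed because \<open>H0_mat l R\<close> has
      only the columns below \<open>n\<close>.\<close>
    define S where "S = {i \<in> \<phi>. ?w $ i \<in> {0, 1}} - {n}"
    have fin: "finite \<phi>" using \<phi> finite_subset by blast
    have "card S \<le> u\<^sub>0"
      using \<zeta> card_Diff1_le[of "{i \<in> \<phi>. ?w $ i \<in> {0, 1}}" n]
      unfolding S_def zeta_choice_def by linarith
    then have "card S < min_dist (mat_kernel (H0_mat l R))" using u0 by simp
    moreover have "finite S" "S \<subseteq> {..<n}" using fin \<phi> by (auto simp: S_def)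
    \<comment> \<open>The prescribed bit turns an entry 0 into 1 and leaves an entry 1
      alone.\<close>
    ultimately have "\<exists>z\<in>carrier_vec l. \<forall>i\<in>S. (z \<^sub>v* H0_mat l R) $ i = (if ?w $ i = 0 then 1 else 0)"
      by (intro row_mult_onto[OF H0c]) (auto intro: kernel_vec_eq_zero[OF H0c])
    then obtain z where z: "z \<in> carrier_vec l"
      "\<And>i. i \<in> S \<Longrightarrow> (z \<^sub>v* H0_mat l R) $ i = (if ?w $ i = 0 then 1 else 0)" by blast
    \<comment> \<open>At position \<open>n\<close> the mask is always 0, so that entry must not
      require a 1.\<close>
    have "\<zeta> + 1 \<noteq> 0" using \<zeta> F_add_one_neq_0 by (simp add: zeta_choice_def)
    then have wn0: "?w $ n \<noteq> 0" using wn[OF \<mu>] by simp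
    have "(?w $ i = 1 \<longrightarrow> (lift_vec z \<^sub>v* H0_ext l R :: 'a vec) $ i = 0) \<and>
          (?w $ i = 0 \<longrightarrow> (lift_vec z \<^sub>v* H0_ext l R :: 'a vec) $ i = 1)" if i: "i \<in> \<phi>" for i
    proof (cases "i = n")
      case True
      then show ?thesis using wn0 mask_at[OF z(1), of n] by simp
    next
      case False
      then have "i < n" using i \<phi> by fastforce
      moreover have "i \<in> S" if "?w $ i \<in> {0, 1}" using that i False by (simp add: S_def)
      ultimately show ?thesis using mask_at[OF z(1), of i] z(2)[of i] by auto
    qed
    then show ?thesis using z(1) unfolding mask_choice_def by blast
  qed

  have Gmat: "G_mat n l k\<^sub>1 P R \<in> carrier_mat (l + (k\<^sub>1 + 1)) (n + 1)"
    unfolding G_mat_def using Hc Gc by (intro carrier_append_rows) auto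
  have C: "C = {w \<in> carrier_vec (n + 1). \<exists>y\<in>carrier_vec (l + (k\<^sub>1 + 1)). y \<^sub>v* G_mat n l k\<^sub>1 P R = w}"
    using assms(23) Gmat vec_space.row_space_eq[OF Gmat]
    by (simp add: generator_matrix_def row_mult_def)
  have C_sub: "C \<subseteq> carrier_vec (n + 1)" using C by auto
  have C_mem: "s \<^sub>v* H0_ext l R + m \<^sub>v* G1_ext l k\<^sub>1 P + a \<cdot>\<^sub>v ones_vec (n + 1) \<in> C"
    if sm: "s \<in> carrier_vec l" "m \<in> carrier_vec k\<^sub>1" for s m a
  proof -
    let ?o = "vec 1 (\<lambda>_. a) :: 'a vec"
    have O: "mat 1 (n + 1) (\<lambda>_. 1 :: 'a) \<in> carrier_mat 1 (n + 1)" by simp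
    have "m @\<^sub>v ?o \<in> carrier_vec (k\<^sub>1 + 1)" using sm by (intro append_carrier_vec) auto
    then have y: "s @\<^sub>v (m @\<^sub>v ?o) \<in> carrier_vec (l + (k\<^sub>1 + 1))" using sm by (intro append_carrier_vec) auto
    \<comment> \<open>The coefficient vector is stacked like the row blocks of the generator matrix,
      with \<open>a\<close> belonging to the all-one row.\<close>
    have "(s @\<^sub>v (m @\<^sub>v ?o)) \<^sub>v* G_mat n l k\<^sub>1 P R
        = s \<^sub>v* H0_ext l R + (m \<^sub>v* G1_ext l k\<^sub>1 P + a \<cdot>\<^sub>v ones_vec (n + 1))"
      unfolding G_mat_def
      using row_mult_append_rows[OF Hc carrier_append_rows[OF Gc O] sm(1) \<open>m @\<^sub>v ?o \<in> _\<close>]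
        row_mult_append_rows[OF Gc O sm(2), of ?o] row_mult_ones[of a "n + 1"] by simp
    also have "\<dots> = s \<^sub>v* H0_ext l R + m \<^sub>v* G1_ext l k\<^sub>1 P + a \<cdot>\<^sub>v ones_vec (n + 1)"
      using row_mult_carrier[OF Hc] row_mult_carrier[OF Gc] ones_n(1)
      by (intro assoc_add_vec[symmetric, where n = "n + 1"]) auto
    finally show ?thesis unfolding C
      using y row_mult_carrier[OF Gmat, of "s @\<^sub>v (m @\<^sub>v ?o)"] by auto
  qed
  have C_dist: "min_dist C \<ge> 2 * t + 1" using assms(25,26) by simp

  have psmc_enc: "psmc leq 1 u t (n + 1) (2 ^ (lam * (k\<^sub>1 + l) - l)) (messages lam x k\<^sub>1 l)
          enc (decoder n l k\<^sub>1 t lam x C R)"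
    if enc: "\<And>\<phi> \<mu>. \<phi> \<subseteq> {0..n} \<Longrightarrow> card \<phi> = u \<Longrightarrow> \<mu> \<in> messages lam x k\<^sub>1 l \<Longrightarrow>
           encoder_output n l k\<^sub>1 lam x u\<^sub>0 P R \<phi> \<mu> (enc \<phi> \<mu>)" for enc
    unfolding psmc_def
  proof (intro conjI allI impI)
    fix \<phi> \<mu> assume a: "\<phi> \<subseteq> {0..<n + 1} \<and> card \<phi> = u \<and> \<mu> \<in> messages lam x k\<^sub>1 l"
    then have \<phi>: "\<phi> \<subseteq> {0..n}" "card \<phi> = u" and \<mu>: "\<mu> \<in> messages lam x k\<^sub>1 l" by auto
    let ?w = "base_word n l k\<^sub>1 P R \<mu>"
    let ?h = "\<lambda>z. lift_vec z \<^sub>v* H0_ext l R :: 'a vec"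
    obtain \<zeta> z where z: "mask_choice l R \<phi> (?w \<zeta>) z" and c: "enc \<phi> \<mu> = ?w \<zeta> + ?h z"
      using enc[OF \<phi> \<mu>] unfolding encoder_output_def by blast
    have zc: "z \<in> carrier_vec l" using z by (simp add: mask_choice_def)
    have hc: "?h z \<in> carrier_vec (n + 1)" by (rule row_mult_carrier[OF Hc])
    show cc: "enc \<phi> \<mu> \<in> carrier_vec (n + 1)" using c wc hc by simp
    show "\<forall>i\<in>\<phi>. (1, enc \<phi> \<mu> $ i) \<in> leq"
    proof
      fix i assume i: "i \<in> \<phi>"
      then have "i < n + 1" using \<phi>(1) by fastforce
      then have ci: "enc \<phi> \<mu> $ i = ?w \<zeta> $ i + ?h z $ i" using c hc by simp
      have "?h z $ i \<in> {0, 1}" using mask_at[OF zc \<open>i < n + 1\<close>]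
        by (cases "(z \<^sub>v* H0_mat l R) $ i") auto
      moreover have "?w \<zeta> $ i = 1 \<longrightarrow> ?h z $ i = 0" "?w \<zeta> $ i = 0 \<longrightarrow> ?h z $ i = 1"
        using z i by (auto simp: mask_choice_def)
      \<comment> \<open>A zero sum would force the entry of \<open>?w\<close> to be a bit as well,
        and for both bits the mask rule makes the sum 1.\<close>
      ultimately have "enc \<phi> \<mu> $ i \<noteq> 0" unfolding ci by (auto simp: add_eq_0_iff2)
      then show "(1, enc \<phi> \<mu> $ i) \<in> leq" using assms(2) by (simp add: level_order_def)
    qed
    obtain m m' where mm: "\<mu> = (m, m')" by (cases \<mu>)
    then have m: "m \<in> carrier_vec k\<^sub>1" and m': "m' \<in> carrier_vec l" "\<And>i. i < l \<Longrightarrow> m' $ i \<in> F"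
      using \<mu> by (auto simp: messages_def)
    \<comment> \<open>Absorbing the mask into the coefficients of \<open>H0_ext\<close> puts the
      output into the form used by \<open>C_mem\<close> and \<open>decoder_correct\<close>.\<close>
    have "(m' + lift_vec z) \<^sub>v* H0_ext l R = m' \<^sub>v* H0_ext l R + ?h z"
      by (rule row_mult_add_left[OF Hc m'(1) lift_vec_carrier[OF zc]])
    then have c': "enc \<phi> \<mu>
        = (m' + lift_vec z) \<^sub>v* H0_ext l R + m \<^sub>v* G1_ext l k\<^sub>1 P + (\<zeta> + 1) \<cdot>\<^sub>v ones_vec (n + 1)"
      using carrier_vecD[OF row_mult_carrier[OF Hc]] carrier_vecD[OF row_mult_carrier[OF Gc]]
        carrier_vecD[OF ones_n(1)]
      by (intro eq_vecI) (auto simp: c[unfolded mm] mm base_word_def)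
    then have cC: "enc \<phi> \<mu> \<in> C" using C_mem[of "m' + lift_vec z" m] m m'(1) zc by simp
    show "\<forall>e\<in>carrier_vec (n + 1). hamming_weight e \<le> t \<longrightarrow>
        decoder n l k\<^sub>1 t lam x C R (enc \<phi> \<mu> + e) = \<mu>"
    proof (intro ballI impI)
      fix e :: "'a vec" assume e: "e \<in> carrier_vec (n + 1)" "hamming_weight e \<le> t"
      have dec: "bounded_dist_decode t C (enc \<phi> \<mu> + e) = enc \<phi> \<mu>"
        by (rule bounded_dist_decode_eq[OF C_sub C_dist cC e])
      show "decoder n l k\<^sub>1 t lam x C R (enc \<phi> \<mu> + e) = \<mu>"
        using decoder_correct[OF R P n m m' zc trans[OF dec c']] unfolding mm .
    qed
  qed (rule card_messages[OF assms(1)])+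
  show ?thesis
  proof (rule conjI; intro allI impI)
    fix \<phi> \<mu> assume "\<phi> \<subseteq> {0..n} \<and> card \<phi> = u \<and> \<mu> \<in> messages lam x k\<^sub>1 l"
    then have a: "\<phi> \<subseteq> {0..n}" "card \<phi> = u" "\<mu> \<in> messages lam x k\<^sub>1 l" by simp_all
    show "(\<exists>\<zeta>. zeta_choice n l k\<^sub>1 lam x u\<^sub>0 P R \<phi> \<mu> \<zeta>) \<and>
        (\<forall>\<zeta>. zeta_choice n l k\<^sub>1 lam x u\<^sub>0 P R \<phi> \<mu> \<zeta> \<longrightarrow>
           (\<exists>z. mask_choice l R \<phi> (base_word n l k\<^sub>1 P R \<mu> \<zeta>) z))"
      by (intro conjI allI impI zeta_ex[OF a] mask_ex[OF a(1,3)])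
  next
    fix enc
    assume enc: "\<forall>\<phi> \<mu>. \<phi> \<subseteq> {0..n} \<and> card \<phi> = u \<and> \<mu> \<in> messages lam x k\<^sub>1 l \<longrightarrow>
           encoder_output n l k\<^sub>1 lam x u\<^sub>0 P R \<phi> \<mu> (enc \<phi> \<mu>)"
    show "psmc leq 1 u t (n + 1) (2 ^ (lam * (k\<^sub>1 + l) - l)) (messages lam x k\<^sub>1 l)
          enc (decoder n l k\<^sub>1 t lam x C R)"
      by (intro psmc_enc enc[rule_format] conjI)
  qed
qed

end
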